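(* Let $n$ be a positive integer and let $k$ be the unique non-negative integer such that $2^k\le n<2^{k+1}$. A bipartition $(\alpha,\beta)$ of $n$ is odd if and only if either $\alpha$ or $\beta$ has a hook of length $2^k$, and the bipartition $(\tilde\alpha,\tilde\beta)$ obtained after removing the rim of this hook is an odd bipartition of $n-2^k$. Moreover, the odd bipartition $(\alpha,\beta)$ is uniquely determined by $(\tilde\alpha,\tilde\beta)$, the leg-length of the hook which was removed, and the knowledge of whether it was removed from $\alpha$ or from $\beta$.
   Context: A bipartition of $n$ is an ordered pair $(\alpha,\beta)$ of integer partitions with $|\alpha|+|\beta|=n$. For a partition $\lambda$, $f_\lambda$ denotes the number of standard Young tableaux of shape $\lambda$. Put $$f_{\alpha\beta}=\frac{n!}{|\alpha|!\,|\beta|!}f_\alpha f_\beta,$$ which is the dimension of the irreducible representation $\rho_{\alpha\beta}$ of the hyperoctahedral group $\mathbb B_n=S_2\wr S_n$ indexed by $(\alpha,\beta)$. The bipartition $(\alpha,\beta)$ is odd if $f_{\alpha\beta}$ is odd. The hook of a cell of a Young diagram consists of the cell, the cells to its right in its row (the arm) and the cells below it in its column (the leg); its length is its number of cells and its leg-length is the number of cells in the leg. Removing the rim of a hook means removing the corresponding rim hook (connected border strip of the same size and leg-length) from the Young diagram; the rim hook is removed from the component ($\alpha$ or $\beta$) that contains the hook, and the other component is left unchanged. *)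

theory Defs
  imports Complex_Main "HOL-Library.FuncSet"
begin

definition is_partition :: "nat list \<Rightarrow> bool" where
  "is_partition \<mu> \<longleftrightarrow> sorted_wrt (\<ge>) \<mu> \<and> (\<forall>m\<in>set \<mu>. 0 < m)"

text \<open>Cells are pairs (row, column), both counted from 0; rows are numbered downwards and
  columns to the right.\<close>

definition diagram :: "nat list \<Rightarrow> (nat \<times> nat) set" where
  "diagram \<mu> = {(i, j). i < length \<mu> \<and> j < \<mu> ! i}"

text \<open>Tableaux are made extensional so that a filling is determined by its values on the cells.\<close>

definition standard_tableaux :: "nat list \<Rightarrow> (nat \<times> nat \<Rightarrow> nat) set" where
  "standard_tableaux \<mu> =
    {T \<in> extensional (diagram \<mu>).
       bij_betw T (diagram \<mu>) {1..sum_list \<mu>} \<and>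
       (\<forall>i j. (i, j + 1) \<in> diagram \<mu> \<longrightarrow> T (i, j) < T (i, j + 1)) \<and>
       (\<forall>i j. (i + 1, j) \<in> diagram \<mu> \<longrightarrow> T (i, j) < T (i + 1, j))}"

definition num_syt :: "nat list \<Rightarrow> nat" where
  "num_syt \<mu> = card (standard_tableaux \<mu>)"

definition bipartition :: "nat \<Rightarrow> nat list \<Rightarrow> nat list \<Rightarrow> bool" where
  "bipartition n \<alpha> \<beta> \<longleftrightarrow>
    is_partition \<alpha> \<and> is_partition \<beta> \<and> sum_list \<alpha> + sum_list \<beta> = n"

text \<open>The division is exact, the quotient being a binomial coefficient.\<close>

definition bip_dim :: "nat list \<Rightarrow> nat list \<Rightarrow> nat" where
  "bip_dim \<alpha> \<beta> =
    fact (sum_list \<alpha> + sum_list \<beta>) div (fact (sum_list \<alpha>) * fact (sum_list \<beta>))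
      * num_syt \<alpha> * num_syt \<beta>"

definition odd_bipartition :: "nat \<Rightarrow> nat list \<Rightarrow> nat list \<Rightarrow> bool" where
  "odd_bipartition n \<alpha> \<beta> \<longleftrightarrow> bipartition n \<alpha> \<beta> \<and> odd (bip_dim \<alpha> \<beta>)"

definition arm :: "nat list \<Rightarrow> nat \<times> nat \<Rightarrow> (nat \<times> nat) set" where
  "arm \<mu> c = {(i, j) \<in> diagram \<mu>. i = fst c \<and> snd c < j}"

definition leg :: "nat list \<Rightarrow> nat \<times> nat \<Rightarrow> (nat \<times> nat) set" where
  "leg \<mu> c = {(i, j) \<in> diagram \<mu>. fst c < i \<and> j = snd c}"

definition hook :: "nat list \<Rightarrow> nat \<times> nat \<Rightarrow> (nat \<times> nat) set" where
  "hook \<mu> c = {c} \<union> arm \<mu> c \<union> leg \<mu> c"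

definition hook_length :: "nat list \<Rightarrow> nat \<times> nat \<Rightarrow> nat" where
  "hook_length \<mu> c = card (hook \<mu> c)"

definition leg_length :: "nat list \<Rightarrow> nat \<times> nat \<Rightarrow> nat" where
  "leg_length \<mu> c = card (leg \<mu> c)"

text \<open>The rim of the diagram consists of the cells with no cell diagonally below and to the
  right. The rim hook of \<open>c\<close> is the stretch of the rim from the end of the arm of \<open>c\<close> to the
  end of its leg.\<close>

definition rim_hook :: "nat list \<Rightarrow> nat \<times> nat \<Rightarrow> (nat \<times> nat) set" where
  "rim_hook \<mu> c =
    {(i, j) \<in> diagram \<mu>. fst c \<le> i \<and> snd c \<le> j \<and> (i + 1, j + 1) \<notin> diagram \<mu>}"

text \<open>The nonzero row lengths of what is left of the diagram.\<close>

definition remove_rim_hook :: "nat list \<Rightarrow> nat \<times> nat \<Rightarrow> nat list" where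
  "remove_rim_hook \<mu> c =
    filter (\<lambda>m. 0 < m)
      (map (\<lambda>i. card {j. (i, j) \<in> diagram \<mu> - rim_hook \<mu> c}) [0..<length \<mu>])"

lemma partition_nth_mono:
  assumes "is_partition \<mu>" "i \<le> i'" "i' < length \<mu>"
  shows "\<mu> ! i' \<le> \<mu> ! i"
  using assms by (cases "i = i'") (auto simp: is_partition_def sorted_wrt_iff_nth_less)

lemma filter_pos_nth:
  assumes "sorted_wrt (\<ge>) (xs :: nat list)"
  shows "i < length (filter (\<lambda>m. 0 < m) xs) \<and> j < filter (\<lambda>m. 0 < m) xs ! i \<longleftrightarrow>
    i < length xs \<and> j < xs ! i"
  using assms
proof (induction xs arbitrary: i)
  case Nil
  then show ?case by simp
next
  case (Cons x xs)
  show ?case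
  proof (cases "x = 0")
    case True
    with Cons.prems have z: "\<forall>y\<in>set (x # xs). y = 0" by simp
    then have "filter (\<lambda>m. 0 < m) (x # xs) = []" by (simp add: filter_empty_conv)
    with z show ?thesis by (metis length_0_conv not_less0 nth_mem)
  next
    case False
    with Cons show ?thesis by (cases i) auto
  qed
qed

lemma
  assumes "is_partition \<mu>"
  shows is_partition_remove_rim_hook: "is_partition (remove_rim_hook \<mu> c)"
    and diagram_remove_rim_hook: "diagram (remove_rim_hook \<mu> c) = diagram \<mu> - rim_hook \<mu> c"
proof -
  define S where "S = diagram \<mu> - rim_hook \<mu> c"
  define r where "r = (\<lambda>i. card {j. (i, j) \<in> S})"
  have D: "(i', j') \<in> diagram \<mu>" if "(i, j) \<in> diagram \<mu>" "i' \<le> i" "j' \<le> j" for i j i' j'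
    using that partition_nth_mono[OF assms, of i' i] by (auto simp: diagram_def)
  have down: "(i', j') \<in> S" if "(i, j) \<in> S" "i' \<le> i" "j' \<le> j" for i j i' j'
    using that D[of i j i' j'] D[of "i + 1" "j + 1" "i' + 1" "j' + 1"]
    by (auto simp: S_def rim_hook_def)
  have row: "{j. (i, j) \<in> S} = {..<r i}" for i
  proof -
    have sub: "{j. (i, j) \<in> S} \<subseteq> {..<\<mu> ! i}" by (auto simp: S_def diagram_def)
    then have fin: "finite {j. (i, j) \<in> S}" using finite_subset by blast
    show ?thesis
    proof (intro set_eqI iffI)
      fix j assume "j \<in> {j. (i, j) \<in> S}"
      then have "{..j} \<subseteq> {j. (i, j) \<in> S}" using down by auto
      from card_mono[OF fin this] show "j \<in> {..<r i}" by (simp add: r_def)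
    next
      fix j assume j: "j \<in> {..<r i}"
      show "j \<in> {j. (i, j) \<in> S}"
      proof (rule ccontr)
        assume "j \<notin> {j. (i, j) \<in> S}"
        then have "{j. (i, j) \<in> S} \<subseteq> {..<j}" using down by (auto simp: not_le[symmetric])
        from card_mono[OF _ this] j show False by (simp add: r_def)
      qed
    qed
  qed
  have mono: "r i' \<le> r i" if "i \<le> i'" for i i'
  proof -
    have "{..<r i'} \<subseteq> {..<r i}" unfolding row[symmetric] using down that by auto
    then show ?thesis by simp
  qed
  have sorted: "sorted_wrt (\<ge>) (map r [0..<length \<mu>])"
    using mono by (auto simp: sorted_wrt_iff_nth_less)
  have eq: "remove_rim_hook \<mu> c = filter (\<lambda>m. 0 < m) (map r [0..<length \<mu>])"
    by (simp add: remove_rim_hook_def r_def S_def)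
  show "is_partition (remove_rim_hook \<mu> c)"
    using sorted unfolding eq is_partition_def by (auto intro: sorted_wrt_filter)
  have "(i, j) \<in> diagram (remove_rim_hook \<mu> c) \<longleftrightarrow> (i, j) \<in> S" for i j
  proof -
    have "(i, j) \<in> diagram (remove_rim_hook \<mu> c) \<longleftrightarrow> i < length \<mu> \<and> j < r i"
      using filter_pos_nth[OF sorted, of i j] by (auto simp: diagram_def eq)
    also have "\<dots> \<longleftrightarrow> i < length \<mu> \<and> (i, j) \<in> S" using row[of i] by auto
    also have "\<dots> \<longleftrightarrow> (i, j) \<in> S" by (auto simp: S_def diagram_def)
    finally show ?thesis .
  qed
  then show "diagram (remove_rim_hook \<mu> c) = diagram \<mu> - rim_hook \<mu> c"
    by (auto simp: S_def)
qed

end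

theory Submission
  imports Defs "HOL-Number_Theory.Cong"
begin

text \<open>A partition is encoded by its set of beads \<open>\<mu>\<^sub>i - i\<close>; the remaining integers are the gaps, one
  for each column. The hook of the cell \<open>(i, j)\<close> has length bead \<open>i\<close> minus gap \<open>j\<close>, and removing its
  rim hook moves bead \<open>i\<close> to gap \<open>j\<close>. By the branching rule, \<open>f\<^sub>\<mu>\<close> counts the ways to lower
  the beads one unit at a time to those of the empty partition. The total lowering operator is a
  sum of commuting shifts, so modulo 2 its \<open>2 ^ k\<close>-th power is the sum of the shifts by \<open>2 ^ k\<close>;
  configurations with coinciding beads cancel by symmetry. Hence \<open>f\<^sub>\<mu>\<close> is congruent to the sum of
  \<open>f\<close> over all removals of rim hooks of length \<open>2 ^ k\<close>. Below size \<open>2 ^ (k + 1)\<close> there is at most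
  one such hook, and the binomial coefficient is treated by Vandermonde's identity modulo 2.

  For uniqueness, the remaining partition has no hook of length \<open>r = 2 ^ k\<close>, so its bead set is closed
  under subtracting \<open>r\<close>. The leg-length of a hook added at \<open>y\<close> is the number of beads strictly
  between \<open>y\<close> and \<open>y + r\<close>, which is strictly decreasing in \<open>y\<close>.\<close>

section \<open>Beads and gaps of a partition\<close>

definition row :: "nat list \<Rightarrow> nat \<Rightarrow> nat" where
  "row \<mu> i = (if i < length \<mu> then \<mu> ! i else 0)"

definition col :: "nat list \<Rightarrow> nat \<Rightarrow> nat" where
  "col \<mu> j = card {i. j < row \<mu> i}"

text \<open>Since \<open>row\<close> is padded with zeros, every natural number indexes a bead and
  the beads past the last part are just the negated indices. Bead sets of partitions of different
  lengths can therefore be compared directly.\<close>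

definition bead :: "nat list \<Rightarrow> nat \<Rightarrow> int" where
  "bead \<mu> i = int (row \<mu> i) - int i"

text \<open>Along the boundary of the diagram, vertical steps are beads and horizontal steps are
  gaps; the offset 1 keeps the two families disjoint.\<close>

definition gap :: "nat list \<Rightarrow> nat \<Rightarrow> int" where
  "gap \<mu> j = int j + 1 - int (col \<mu> j)"

lemma mem_diagram: "(i, j) \<in> diagram \<mu> \<longleftrightarrow> j < row \<mu> i"
  by (auto simp: diagram_def row_def)

lemma row_antimono: "is_partition \<mu> \<Longrightarrow> i \<le> i' \<Longrightarrow> row \<mu> i' \<le> row \<mu> i"
  by (auto simp: row_def intro: partition_nth_mono)

lemma less_col_iff:
  assumes "is_partition \<mu>"
  shows "i < col \<mu> j \<longleftrightarrow> j < row \<mu> i"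
proof -
  define c where "c = (LEAST i. \<not> j < row \<mu> i)"
  have "\<not> j < row \<mu> (length \<mu>)" by (simp add: row_def)
  then have c: "\<not> j < row \<mu> c" unfolding c_def by (rule LeastI)
  have *: "j < row \<mu> i \<longleftrightarrow> i < c" for i
    using c row_antimono[OF assms, of c i] not_less_Least[of i "\<lambda>i. \<not> j < row \<mu> i"]
    unfolding c_def[symmetric] by (meson le_less_trans not_less order.strict_trans2)
  then have "{i. j < row \<mu> i} = {..<c}" by auto
  then show ?thesis by (simp add: col_def *)
qed

lemma bead_strict: "is_partition \<mu> \<Longrightarrow> i < i' \<Longrightarrow> bead \<mu> i' < bead \<mu> i"
  using row_antimono[of \<mu> i i'] by (simp add: bead_def)

lemma bead_less_iff: "is_partition \<mu> \<Longrightarrow> bead \<mu> i < bead \<mu> i' \<longleftrightarrow> i' < i"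
  using bead_strict[of \<mu> i i'] bead_strict[of \<mu> i' i] by (cases i i' rule: linorder_cases) auto

lemma inj_bead: "is_partition \<mu> \<Longrightarrow> inj (bead \<mu>)"
  by (rule injI) (metis bead_less_iff less_irrefl linorder_neqE_nat)

text \<open>Write \<open>bead \<mu> i - gap \<mu> j\<close> as
  \<open>(row \<mu> i - j) + (col \<mu> j - i) - 1\<close>. By \<open>less_col_iff\<close> the two
  brackets are both positive or both at most 0, so the difference is never 0.\<close>

lemma gap_less_bead_iff:
  assumes "is_partition \<mu>"
  shows "gap \<mu> j < bead \<mu> i \<longleftrightarrow> j < row \<mu> i"
    and "bead \<mu> i < gap \<mu> j \<longleftrightarrow> \<not> j < row \<mu> i"
  using less_col_iff[OF assms, of i j] by (auto simp: gap_def bead_def)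

lemma gap_not_bead: "is_partition \<mu> \<Longrightarrow> gap \<mu> j \<notin> range (bead \<mu>)"
  using gap_less_bead_iff(1)[of \<mu> j] gap_less_bead_iff(2)[of \<mu> _ j]
  by (metis imageE less_irrefl)

lemma inj_gap:
  assumes "is_partition \<mu>"
  shows "inj (gap \<mu>)"
proof -
  have "col \<mu> j' \<le> col \<mu> j" if "j < j'" for j j'
    using less_col_iff[OF assms, of "col \<mu> j" j] less_col_iff[OF assms, of "col \<mu> j" j'] that
    by (meson less_irrefl less_trans not_less)
  then have "strict_mono (gap \<mu>)" by (force simp: strict_mono_def gap_def)
  then show ?thesis by (rule strict_mono_imp_inj_on)
qed

text \<open>If exactly \<open>c\<close> beads lie above the free position \<open>y\<close>, then the
  column whose gap is \<open>y\<close> must have \<open>c\<close> cells, which determines its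
  index.\<close>

lemma gap_surj:
  assumes \<mu>: "is_partition \<mu>" and y: "y \<notin> range (bead \<mu>)"
  shows "y \<in> range (gap \<mu>)"
proof -
  define c where "c = (LEAST l. bead \<mu> l < y)"
  have "bead \<mu> (length \<mu> + nat (1 - y)) < y" by (simp add: bead_def row_def)
  then have c: "bead \<mu> c < y" unfolding c_def by (rule LeastI)
  have c': "y < bead \<mu> l" if "l < c" for l
    using not_less_Least that y unfolding c_def by (metis linorder_neqE rangeI)
  \<comment> \<open>Solves \<open>gap \<mu> j = y\<close> for \<open>col \<mu> j = c\<close>.
    Nothing is lost by \<open>nat\<close>, because \<open>y\<close> exceeds the bead of row
    \<open>c\<close>, which is at least \<open>-c\<close>.\<close>
  define j where "j = nat (y + int c - 1)"
  have j: "int j = y + int c - 1" using c by (simp add: j_def bead_def)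
  have "j < row \<mu> l \<longleftrightarrow> l < c" for l
  proof
    assume "l < c"
    then have "row \<mu> (c - 1) \<le> row \<mu> l" by (intro row_antimono \<mu>) auto
    with c'[of "c - 1"] \<open>l < c\<close> j show "j < row \<mu> l" by (simp add: bead_def of_nat_diff)
  next
    assume "j < row \<mu> l"
    show "l < c"
    proof (rule ccontr)
      assume "\<not> l < c"
      then have "row \<mu> l \<le> row \<mu> c" by (intro row_antimono \<mu>) auto
      with c j \<open>j < row \<mu> l\<close> show False by (simp add: bead_def)
    qed
  qed
  then have "{l. j < row \<mu> l} = {..<c}" by auto
  then have "gap \<mu> j = y" using j by (simp add: gap_def col_def)
  then show ?thesis by blast
qed

lemma row_eqI:
  assumes "is_partition \<mu>" "is_partition \<nu>" "row \<mu> = row \<nu>"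
  shows "\<mu> = \<nu>"
proof -
  have *: "i < length \<mu> \<longleftrightarrow> 0 < row \<mu> i" if "is_partition \<mu>" for i \<mu>
    using that by (auto simp: row_def is_partition_def)
  have l: "length \<mu> = length \<nu>"
    using *[OF assms(1)] *[OF assms(2)] assms(3) by (metis linorder_neqE_nat less_irrefl)
  show ?thesis
    using l assms(3) by (intro nth_equalityI) (auto simp: row_def fun_eq_iff split: if_splits)
qed

text \<open>A strictly decreasing sequence is determined by its set of values.\<close>

lemma range_bead_eqD:
  assumes \<mu>: "is_partition \<mu>" and \<nu>: "is_partition \<nu>" and eq: "range (bead \<mu>) = range (bead \<nu>)"
  shows "\<mu> = \<nu>"
proof -
  have "bead \<mu> i = bead \<nu> i" for i
  proof (induction i rule: less_induct)
    case (less i)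
    obtain a where a: "bead \<mu> i = bead \<nu> a" using eq by (metis rangeE rangeI)
    obtain b where b: "bead \<nu> i = bead \<mu> b" using eq by (metis rangeE rangeI)
    have "\<not> a < i" using less[of a] a bead_strict[OF \<mu>, of a i] by auto
    moreover have "\<not> b < i" using less[of b] b bead_strict[OF \<nu>, of b i] by auto
    ultimately show ?case
      using a b bead_strict[OF \<mu>, of i b] bead_strict[OF \<nu>, of i a]
      by (metis linorder_neqE_nat order.asym)
  qed
  then have "row \<mu> = row \<nu>" by (auto simp: bead_def fun_eq_iff)
  then show ?thesis by (rule row_eqI[OF \<mu> \<nu>])
qed

section \<open>Hooks and rim hook removal in terms of beads\<close>

lemma leg_length_eq:
  assumes "is_partition \<mu>"
  shows "leg_length \<mu> (i, j) = card {i<..<col \<mu> j}"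
proof -
  have "leg \<mu> (i, j) = (\<lambda>l. (l, j)) ` {i<..<col \<mu> j}"
    by (auto simp: leg_def mem_diagram less_col_iff[OF assms])
  then show ?thesis by (simp add: leg_length_def card_image inj_on_def)
qed

text \<open>Corner, arm and leg contribute 1, \<open>row \<mu> i - j - 1\<close> and
  \<open>col \<mu> j - i - 1\<close>.\<close>

lemma hook_length_eq:
  assumes \<mu>: "is_partition \<mu>" and j: "j < row \<mu> i"
  shows "int (hook_length \<mu> (i, j)) = bead \<mu> i - gap \<mu> j"
proof -
  have L: "leg \<mu> (i, j) = (\<lambda>l. (l, j)) ` {i<..<col \<mu> j}"
    by (auto simp: leg_def mem_diagram less_col_iff[OF \<mu>])
  have A: "arm \<mu> (i, j) = Pair i ` {j<..<row \<mu> i}"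
    by (auto simp: arm_def mem_diagram)
  have "hook_length \<mu> (i, j) = Suc (card (arm \<mu> (i, j) \<union> leg \<mu> (i, j)))"
    unfolding hook_length_def hook_def by (subst Un_assoc, simp add: L A image_iff)
  also have "card (arm \<mu> (i, j) \<union> leg \<mu> (i, j)) = card (arm \<mu> (i, j)) + card (leg \<mu> (i, j))"
    unfolding L A by (intro card_Un_disjoint) auto
  finally show ?thesis
    using j less_col_iff[OF \<mu>, of i j]
    by (simp add: L A card_image inj_on_def bead_def gap_def)
qed

text \<open>A free position is a gap, and a gap below the bead of row \<open>i\<close> belongs to a
  column meeting that row.\<close>

lemma hook_exists:
  assumes \<mu>: "is_partition \<mu>" and r: "0 < r" and y: "bead \<mu> i - int r \<notin> range (bead \<mu>)"
  shows "\<exists>j. (i, j) \<in> diagram \<mu> \<and> hook_length \<mu> (i, j) = r"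
proof -
  obtain j where j: "gap \<mu> j = bead \<mu> i - int r" using gap_surj[OF \<mu> y] by (metis rangeE)
  then have "j < row \<mu> i" using gap_less_bead_iff(1)[OF \<mu>, of j i] r by simp
  with hook_length_eq[OF \<mu> this] j show ?thesis by (auto simp: mem_diagram)
qed

text \<open>Each row of the rim hook except the last shrinks to the length of the next row minus 1,
  which is the bead of that next row; the last one, row \<open>col \<mu> j - 1\<close>, keeps
  \<open>j\<close> cells, and its bead becomes the gap.\<close>

lemma bead_remove_rim_hook:
  assumes \<mu>: "is_partition \<mu>" and j: "j < row \<mu> i"
  shows "bead (remove_rim_hook \<mu> (i, j)) l =
    (if i \<le> l \<and> l + 1 < col \<mu> j then bead \<mu> (l + 1)
     else if l + 1 = col \<mu> j then gap \<mu> j else bead \<mu> l)"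
proof -
  let ?\<nu> = "remove_rim_hook \<mu> (i, j)"
  have nat_eqI: "a = b" if "\<And>t. t < a \<longleftrightarrow> t < b" for a b :: nat
    using that by (metis linorder_neqE_nat less_irrefl)
  have i: "i < col \<mu> j" using j by (simp add: less_col_iff[OF \<mu>])
  have 1: "j < row \<mu> (l + 1) \<longleftrightarrow> l + 1 < col \<mu> j" by (simp add: less_col_iff[OF \<mu>])
  have mono: "row \<mu> (l + 1) \<le> row \<mu> l" by (intro row_antimono \<mu>) simp
  have "row ?\<nu> l =
    (if i \<le> l \<and> l + 1 < col \<mu> j then row \<mu> (l + 1) - 1
     else if l + 1 = col \<mu> j then j else row \<mu> l)"
  proof (rule nat_eqI)
    fix t
    have t: "t < row ?\<nu> l \<longleftrightarrow> t < row \<mu> l \<and> \<not> (i \<le> l \<and> j \<le> t \<and> \<not> t + 1 < row \<mu> (l + 1))"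
      using diagram_remove_rim_hook[OF \<mu>, of "(i, j)"] mem_diagram[of l t ?\<nu>]
      by (auto simp: rim_hook_def mem_diagram)
    consider "l < i" | "i \<le> l" "l + 1 < col \<mu> j" | "l + 1 = col \<mu> j" | "col \<mu> j \<le> l"
      by linarith
    then show "t < row ?\<nu> l \<longleftrightarrow> t < (if i \<le> l \<and> l + 1 < col \<mu> j then row \<mu> (l + 1) - 1
       else if l + 1 = col \<mu> j then j else row \<mu> l)"
    proof cases
      case 1
      then show ?thesis using i t by simp
    next
      case 2
      then have "j < row \<mu> (l + 1)" using less_col_iff[OF \<mu>] by simp
      then have "t < row \<mu> l \<and> \<not> (j \<le> t \<and> \<not> t + 1 < row \<mu> (l + 1)) \<longleftrightarrow> t < row \<mu> (l + 1) - 1"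
        using mono by linarith
      then show ?thesis using 2 unfolding t by simp
    next
      case 3
      then have "\<not> j < row \<mu> (l + 1)" "j < row \<mu> l" "i \<le> l"
        using less_col_iff[OF \<mu>, of _ j, symmetric] i by auto
      then have "t < row \<mu> l \<and> \<not> (j \<le> t \<and> \<not> t + 1 < row \<mu> (l + 1)) \<longleftrightarrow> t < j"
        by linarith
      then show ?thesis using 3 \<open>i \<le> l\<close> unfolding t by simp
    next
      case 4
      then have "\<not> j < row \<mu> l" using less_col_iff[OF \<mu>, of l j] by simp
      then have "t < row \<mu> l \<and> \<not> (i \<le> l \<and> j \<le> t \<and> \<not> t + 1 < row \<mu> (l + 1)) \<longleftrightarrow> t < row \<mu> l"
        by linarith
      then show ?thesis using 4 unfolding t by simp
    qed
  qed
  then show ?thesis using 1 by (auto simp: bead_def gap_def)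
qed

text \<open>As a set, the beads change only by moving bead \<open>i\<close> to gap \<open>j\<close>.
  The general \<open>S\<close> covers both the full sequence and a finite initial segment containing
  all rows of the hook.\<close>

lemma bead_remove_image:
  assumes \<mu>: "is_partition \<mu>" and j: "j < row \<mu> i" and S: "{..<col \<mu> j} \<subseteq> S"
  shows "bead (remove_rim_hook \<mu> (i, j)) ` S = insert (gap \<mu> j) (bead \<mu> ` (S - {i}))"
    (is "?f ` S = _")
proof -
  note b = bead_remove_rim_hook[OF \<mu> j]
  have i: "i < col \<mu> j" using j by (simp add: less_col_iff[OF \<mu>])
  show ?thesis
  proof (intro equalityI subsetI)
    fix z assume "z \<in> ?f ` S"
    then obtain l where "l \<in> S" "z = ?f l" by blast
    then show "z \<in> insert (gap \<mu> j) (bead \<mu> ` (S - {i}))"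
      using i S by (cases "l = i") (auto simp: b split: if_splits)
  next
    fix z assume "z \<in> insert (gap \<mu> j) (bead \<mu> ` (S - {i}))"
    then consider "z = gap \<mu> j" | l where "l \<in> S" "l \<noteq> i" "z = bead \<mu> l" by blast
    then show "z \<in> ?f ` S"
    proof cases
      case 1
      then have "z = ?f (col \<mu> j - 1)" using i by (simp add: b)
      moreover have "col \<mu> j - 1 \<in> S" using i S by auto
      ultimately show ?thesis by blast
    next
      case (2 l)
      show ?thesis
      proof (cases "i < l \<and> l < col \<mu> j")
        case True
        then have "i \<le> l - 1" "l - 1 + 1 = l" by auto
        then have "z = ?f (l - 1)" using 2 True by (simp add: b)
        moreover have "l - 1 \<in> S" using True S by auto
        ultimately show ?thesis by blast
      next
        case False
        then have "z = ?f l" using 2 i by (auto simp: b)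
        with 2 show ?thesis by blast
      qed
    qed
  qed
qed

lemma range_bead_remove:
  assumes "is_partition \<mu>" "j < row \<mu> i"
  shows "range (bead (remove_rim_hook \<mu> (i, j))) =
    insert (gap \<mu> j) (range (bead \<mu>) - {bead \<mu> i})"
proof -
  have "bead \<mu> ` (UNIV - {i}) = range (bead \<mu>) - {bead \<mu> i}"
    using inj_bead[OF assms(1)] by (simp add: image_set_diff)
  then show ?thesis using bead_remove_image[OF assms, of UNIV] by simp
qed

lemma sum_list_row: "length \<mu> \<le> m \<Longrightarrow> sum_list \<mu> = (\<Sum>l<m. row \<mu> l)"
proof -
  assume m: "length \<mu> \<le> m"
  have "(\<Sum>l<m. row \<mu> l) = (\<Sum>l<length \<mu>. row \<mu> l)"
    by (rule sum.mono_neutral_right) (use m in \<open>auto simp: row_def\<close>)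
  also have "\<dots> = (\<Sum>l<length \<mu>. \<mu> ! l)" by (simp add: row_def)
  finally show ?thesis by (simp add: sum_list_sum_nth atLeast0LessThan)
qed

lemma sum_bead: "length \<mu> \<le> m \<Longrightarrow> (\<Sum>l<m. bead \<mu> l) = int (sum_list \<mu>) - (\<Sum>l<m. int l)"
  by (simp add: sum_list_row bead_def sum_subtractf)

lemma length_remove: "length (remove_rim_hook \<mu> c) \<le> length \<mu>"
  by (simp add: remove_rim_hook_def)
     (metis (no_types, lifting) length_filter_le length_map length_upt diff_zero)

lemma col_le_length: "is_partition \<mu> \<Longrightarrow> col \<mu> j \<le> length \<mu>"
  using less_col_iff[of \<mu> "length \<mu>" j] by (simp add: row_def)

text \<open>For a fixed number of beads, the size of the partition is the sum of the beads up to a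
  constant, and removal lowers one bead by the hook length.\<close>

lemma sum_list_remove:
  assumes \<mu>: "is_partition \<mu>" and c: "c \<in> diagram \<mu>"
  shows "sum_list (remove_rim_hook \<mu> c) + hook_length \<mu> c = sum_list \<mu>"
proof -
  obtain i j where ij: "c = (i, j)" by force
  have j: "j < row \<mu> i" using c by (simp add: ij mem_diagram)
  let ?m = "length \<mu>" and ?\<nu> = "remove_rim_hook \<mu> (i, j)"
  have i: "i < ?m" using j by (auto simp: row_def split: if_splits)
  have "(\<Sum>l<?m. bead ?\<nu> l) = \<Sum>(bead ?\<nu> ` {..<?m})"
    by (subst sum.reindex) (auto intro: inj_on_subset[OF inj_bead[OF is_partition_remove_rim_hook[OF \<mu>]]])
  also have "bead ?\<nu> ` {..<?m} = insert (gap \<mu> j) (bead \<mu> ` ({..<?m} - {i}))"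
    by (rule bead_remove_image[OF \<mu> j]) (use col_le_length[OF \<mu>] in auto)
  also have "\<Sum>\<dots> = gap \<mu> j + \<Sum>(bead \<mu> ` ({..<?m} - {i}))"
    using gap_not_bead[OF \<mu>, of j] by (subst sum.insert) auto
  also have "\<Sum>(bead \<mu> ` ({..<?m} - {i})) = (\<Sum>l\<in>{..<?m} - {i}. bead \<mu> l)"
    by (subst sum.reindex) (auto intro: inj_on_subset[OF inj_bead[OF \<mu>]])
  also have "\<dots> = (\<Sum>l<?m. bead \<mu> l) - bead \<mu> i"
    using i by (subst sum_diff1) auto
  finally show ?thesis
    using sum_bead[of \<mu> ?m] sum_bead[OF length_remove, of \<mu> "(i, j)"] hook_length_eq[OF \<mu> j]
    unfolding ij by simp
qed

lemma hook_length_le: "is_partition \<mu> \<Longrightarrow> c \<in> diagram \<mu> \<Longrightarrow> hook_length \<mu> c \<le> sum_list \<mu>"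
  using sum_list_remove[of \<mu> c] by simp

text \<open>Two beads that can be moved down by \<open>r\<close> can be moved one after the other.\<close>

lemma hook_unique:
  assumes \<mu>: "is_partition \<mu>" and c: "c \<in> diagram \<mu>" "c' \<in> diagram \<mu>"
    and h: "hook_length \<mu> c = r" "hook_length \<mu> c' = r" and small: "sum_list \<mu> < 2 * r"
  shows "c = c'"
proof (rule ccontr)
  assume ne: "c \<noteq> c'"
  obtain i j i' j' where ij: "c = (i, j)" "c' = (i', j')" by (cases c; cases c')
  have j: "j < row \<mu> i" "j' < row \<mu> i'" using c by (simp_all add: ij mem_diagram)
  have g: "gap \<mu> j = bead \<mu> i - int r" "gap \<mu> j' = bead \<mu> i' - int r"
    using hook_length_eq[OF \<mu> j(1)] hook_length_eq[OF \<mu> j(2)] h by (simp_all add: ij)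
  have "j \<noteq> j'" using ne g inj_bead[OF \<mu>] by (auto simp: ij inj_eq)
  then have gn: "gap \<mu> j \<noteq> gap \<mu> j'" using inj_gap[OF \<mu>] by (simp add: inj_eq)
  define \<nu> where "\<nu> = remove_rim_hook \<mu> c"
  have \<nu>: "is_partition \<nu>" by (simp add: \<nu>_def is_partition_remove_rim_hook[OF \<mu>])
  have R: "range (bead \<nu>) = insert (gap \<mu> j) (range (bead \<mu>) - {bead \<mu> i})"
    unfolding \<nu>_def ij by (rule range_bead_remove[OF \<mu> j(1)])
  have "bead \<mu> i' \<in> range (bead \<nu>)" using R gn g by auto
  then obtain a where a: "bead \<mu> i' = bead \<nu> a" by blast
  have "bead \<nu> a - int r \<notin> range (bead \<nu>)"
    using R gn gap_not_bead[OF \<mu>, of j'] g(2) a by simp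
  moreover have "0 < r"
    using g(1) gap_less_bead_iff(1)[OF \<mu>, of j i] j by simp
  ultimately obtain b where b: "(a, b) \<in> diagram \<nu>" "hook_length \<nu> (a, b) = r"
    using hook_exists[OF \<nu>] by blast
  \<comment> \<open>The second hook needs \<open>r\<close> cells besides the \<open>r\<close>
    already removed, so \<mu> would have at least \<open>2 * r\<close> cells.\<close>
  have "r \<le> sum_list \<nu>" using hook_length_le[OF \<nu> b(1)] b(2) by simp
  with sum_list_remove[OF \<mu> c(1)] h small show False by (simp add: \<nu>_def)
qed

section \<open>Uniqueness from the leg-length\<close>

text \<open>The beads below that of row \<open>i\<close> and above the gap of column
  \<open>j\<close> are those of the lower rows reaching column \<open>j\<close>, one for each cell
  of the leg.\<close>

lemma leg_length_card:
  assumes \<mu>: "is_partition \<mu>"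
  shows "leg_length \<mu> (i, j) = card (range (bead \<mu>) \<inter> {gap \<mu> j<..<bead \<mu> i})"
proof -
  have "range (bead \<mu>) \<inter> {gap \<mu> j<..<bead \<mu> i} = bead \<mu> ` {i<..<col \<mu> j}"
    by (auto simp: gap_less_bead_iff[OF \<mu>] less_col_iff[OF \<mu>] bead_less_iff[OF \<mu>])
  then show ?thesis
    by (simp add: leg_length_eq[OF \<mu>] card_image inj_on_subset[OF inj_bead[OF \<mu>]])
qed

text \<open>Shifting down by \<open>r\<close> maps the elements between \<open>y + r\<close> and \<open>y' + r\<close> into
  those between \<open>y\<close> and \<open>y'\<close>, and \<open>y'\<close> is an extra element on the left.\<close>

lemma core_count_less:
  fixes Y :: "int set"
  assumes core: "\<And>z. z \<in> Y \<Longrightarrow> z - r \<in> Y" and r: "0 < r"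
    and y: "y + r \<notin> Y" and y': "y' \<in> Y" and less: "y < y'"
  shows "card (Y \<inter> {y'<..<y' + r}) < card (Y \<inter> {y<..<y + r})"
proof -
  \<comment> \<open>This interval is split in two ways, at \<open>y'\<close> and at
    \<open>y + r\<close>; the latter point may be dropped because it is not in
    \<open>Y\<close>.\<close>
  let ?N = "card (Y \<inter> {y<..<y' + r})"
  have "Y \<inter> {y<..<y' + r} = (Y \<inter> {y<..y'}) \<union> (Y \<inter> {y'<..<y' + r})" using less r by auto
  then have 1: "?N = card (Y \<inter> {y<..y'}) + card (Y \<inter> {y'<..<y' + r})"
    by (simp add: card_Un_disjoint disjoint_iff)
  have "Y \<inter> {y<..<y' + r} = (Y \<inter> {y<..<y + r}) \<union> (Y \<inter> {y + r<..<y' + r})"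
  proof -
    have "z \<noteq> y + r" if "z \<in> Y" for z using that y by blast
    then show ?thesis using less r by force
  qed
  then have 2: "?N = card (Y \<inter> {y<..<y + r}) + card (Y \<inter> {y + r<..<y' + r})"
    by (simp add: card_Un_disjoint disjoint_iff)
  have "card (Y \<inter> {y + r<..<y' + r}) = card ((\<lambda>z. z - r) ` (Y \<inter> {y + r<..<y' + r}))"
    by (simp add: card_image inj_on_def)
  also have "\<dots> \<le> card (Y \<inter> {y<..<y'})"
    by (rule card_mono) (auto dest: core)
  also have "\<dots> < card (Y \<inter> {y<..y'})"
    by (rule psubset_card_mono) (use y' less in auto)
  finally show ?thesis using 1 2 by simp
qed

text \<open>Both partitions arise from the common remainder by raising one bead by \<open>r\<close>,
  and the leg-length tells which bead was raised.\<close>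

lemma removed_determines:
  assumes \<alpha>: "is_partition \<alpha>" and \<beta>: "is_partition \<beta>"
    and c: "c \<in> diagram \<alpha>" and c': "c' \<in> diagram \<beta>"
    and h: "hook_length \<alpha> c = r" "hook_length \<beta> c' = r"
    and leg: "leg_length \<alpha> c = leg_length \<beta> c'"
    and eq: "remove_rim_hook \<alpha> c = remove_rim_hook \<beta> c'"
    and small: "sum_list \<alpha> < 2 * r"
  shows "\<alpha> = \<beta>"
proof -
  define \<nu> where "\<nu> = remove_rim_hook \<alpha> c"
  define Y where "Y = range (bead \<nu>)"
  have \<nu>: "is_partition \<nu>" by (simp add: \<nu>_def is_partition_remove_rim_hook[OF \<alpha>])
  have \<nu>_small: "sum_list \<nu> < r" using sum_list_remove[OF \<alpha> c] small h by (simp add: \<nu>_def)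
  then have r: "0 < r" by simp
  \<comment> \<open>A bead that could drop by \<open>r\<close> onto a free position would give a
    hook of length \<open>r\<close> in a partition with fewer than \<open>r\<close> cells.\<close>
  have core: "z - int r \<in> Y" if "z \<in> Y" for z
  proof (rule ccontr)
    assume "z - int r \<notin> Y"
    moreover obtain a where "z = bead \<nu> a" using \<open>z \<in> Y\<close> by (auto simp: Y_def)
    ultimately obtain b where "(a, b) \<in> diagram \<nu>" "hook_length \<nu> (a, b) = r"
      using hook_exists[OF \<nu> r] unfolding Y_def by blast
    with hook_length_le[OF \<nu>] \<nu>_small show False by fastforce
  qed
  \<comment> \<open>Here \<open>y\<close> is the gap of \<mu> that the removal fills. The endpoints
    are excluded from the count, so the beads counted are the same before and after.\<close>
  have add: "\<exists>y. y \<in> Y \<and> y + int r \<notin> Y \<and> range (bead \<mu>) = insert (y + int r) (Y - {y}) \<and>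
      leg_length \<mu> d = card (Y \<inter> {y<..<y + int r})"
    if \<mu>: "is_partition \<mu>" and d: "d \<in> diagram \<mu>" "hook_length \<mu> d = r" "remove_rim_hook \<mu> d = \<nu>"
    for \<mu> d
  proof -
    obtain i j where ij: "d = (i, j)" by force
    have j: "j < row \<mu> i" using d by (simp add: ij mem_diagram)
    have g: "bead \<mu> i = gap \<mu> j + int r" using hook_length_eq[OF \<mu> j] d by (simp add: ij)
    have R: "Y = insert (gap \<mu> j) (range (bead \<mu>) - {bead \<mu> i})"
      using range_bead_remove[OF \<mu> j] d by (simp add: Y_def ij)
    have gm: "gap \<mu> j \<notin> range (bead \<mu>)" by (rule gap_not_bead[OF \<mu>])
    have "Y \<inter> {gap \<mu> j<..<bead \<mu> i} = range (bead \<mu>) \<inter> {gap \<mu> j<..<bead \<mu> i}"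
      unfolding R by auto
    then have "leg_length \<mu> d = card (Y \<inter> {gap \<mu> j<..<gap \<mu> j + int r})"
      using leg_length_card[OF \<mu>, of i j] g by (simp add: ij)
    moreover have "range (bead \<mu>) = insert (bead \<mu> i) (Y - {gap \<mu> j})"
      unfolding R using gm by auto
    moreover have "bead \<mu> i \<notin> Y" unfolding R using g r by auto
    moreover have "gap \<mu> j \<in> Y" unfolding R by simp
    ultimately show ?thesis unfolding g by blast
  qed
  obtain y where y: "y \<in> Y" "y + int r \<notin> Y" "range (bead \<alpha>) = insert (y + int r) (Y - {y})"
      "leg_length \<alpha> c = card (Y \<inter> {y<..<y + int r})"
    using add[OF \<alpha> c h(1)] \<nu>_def by blast
  obtain y' where y': "y' \<in> Y" "y' + int r \<notin> Y" "range (bead \<beta>) = insert (y' + int r) (Y - {y'})"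
      "leg_length \<beta> c' = card (Y \<inter> {y'<..<y' + int r})"
    using add[OF \<beta> c' h(2)] \<nu>_def eq by auto
  have "y = y'"
    using core_count_less[of Y "int r" y y'] core_count_less[of Y "int r" y' y] core r y y' leg
    by (cases y y' rule: linorder_cases) auto
  with y y' have "range (bead \<alpha>) = range (bead \<beta>)" by simp
  then show ?thesis by (rule range_bead_eqD[OF \<alpha> \<beta>])
qed

section \<open>Shift operators and path counts modulo 2\<close>

definition shift_sum :: "'a set \<Rightarrow> int \<Rightarrow> (('a \<Rightarrow> int) \<Rightarrow> nat) \<Rightarrow> ('a \<Rightarrow> int) \<Rightarrow> nat" where
  "shift_sum I r g x = (\<Sum>i\<in>I. g (x(i := x i - r)))"

text \<open>Off-diagonal terms occur in equal pairs and cancel modulo 2.\<close>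

lemma symmetric_double_sum_cong:
  fixes G :: "'a \<Rightarrow> 'a \<Rightarrow> nat"
  assumes "finite I" and "\<And>i j. G i j = G j i"
  shows "[(\<Sum>i\<in>I. \<Sum>j\<in>I. G i j) = (\<Sum>i\<in>I. G i i)] (mod 2)"
  using assms(1)
proof (induction I)
  case empty
  then show ?case by simp
next
  case (insert a I)
  have "(\<Sum>i\<in>I. G i a) = (\<Sum>i\<in>I. G a i)" by (intro sum.cong refl assms(2))
  then have "(\<Sum>i\<in>insert a I. \<Sum>j\<in>insert a I. G i j) =
      G a a + (\<Sum>i\<in>I. \<Sum>j\<in>I. G i j) + 2 * (\<Sum>j\<in>I. G a j)"
    using insert by (simp add: sum.distrib)
  also have "[\<dots> = G a a + (\<Sum>i\<in>I. G i i)] (mod 2)"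
    using cong_add[OF cong_refl[of "G a a"] insert.IH] by (simp add: cong_def)
  finally show ?case using insert by simp
qed

text \<open>Lowering two coordinates is independent of the order, so the double sum is symmetric;
  its diagonal lowers a single coordinate twice.\<close>

lemma shift_sum_double:
  assumes "finite I"
  shows "[shift_sum I r (shift_sum I r g) x = shift_sum I (2 * r) g x] (mod 2)"
proof -
  define G where "G i j = g ((x(i := x i - r))(j := (x(i := x i - r)) j - r))" for i j
  have "G i j = G j i" for i j
    by (cases "i = j") (auto simp: G_def fun_upd_twist)
  from symmetric_double_sum_cong[OF assms this]
  show ?thesis by (simp add: shift_sum_def G_def)
qed

text \<open>Frobenius: modulo 2, the \<open>2 ^ k\<close>-th power of a sum of commuting operators is the sum of
  their \<open>2 ^ k\<close>-th powers.\<close>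

lemma shift_sum_power:
  assumes "finite I"
  shows "[(shift_sum I 1 ^^ (2 ^ k)) g x = shift_sum I (2 ^ k) g x] (mod 2)"
proof (induction k arbitrary: g x)
  case 0
  show ?case by simp
next
  case (Suc k)
  have "(shift_sum I 1 ^^ (2 ^ Suc k)) g x =
      (shift_sum I 1 ^^ (2 ^ k)) ((shift_sum I 1 ^^ (2 ^ k)) g) x"
    by (simp add: mult_2 funpow_add)
  \<comment> \<open>The hypothesis is used here for the iterated function in place of
    \<open>g\<close>, and next at every shifted point, which is why the induction generalises
    both.\<close>
  also have "[\<dots> = shift_sum I (2 ^ k) ((shift_sum I 1 ^^ (2 ^ k)) g) x] (mod 2)"
    by (rule Suc.IH)
  also have "[shift_sum I (2 ^ k) ((shift_sum I 1 ^^ (2 ^ k)) g) x =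
      shift_sum I (2 ^ k) (shift_sum I (2 ^ k) g) x] (mod 2)"
    unfolding shift_sum_def[of I "2 ^ k" _ x] by (intro cong_sum Suc.IH)
  also have "[shift_sum I (2 ^ k) (shift_sum I (2 ^ k) g) x = shift_sum I (2 ^ Suc k) g x] (mod 2)"
    using shift_sum_double[OF assms] by simp
  finally show ?case .
qed

text \<open>The number of ways to reach the bead configuration of the empty partition in \<open>s\<close> unit
  steps. Configurations that are not injective are allowed on the way; modulo 2 they
  contribute nothing.\<close>

definition paths :: "nat \<Rightarrow> nat \<Rightarrow> (nat \<Rightarrow> int) \<Rightarrow> nat" where
  "paths m s = (shift_sum {..<m} 1 ^^ s)
     (\<lambda>x. of_bool (x ` {..<m} = (\<lambda>i. - int i) ` {..<m}))"

lemma paths_0: "paths m 0 x = of_bool (x ` {..<m} = (\<lambda>i. - int i) ` {..<m})"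
  by (simp add: paths_def)

lemma paths_Suc: "paths m (Suc s) x = (\<Sum>i<m. paths m s (x(i := x i - 1)))"
  by (simp add: paths_def shift_sum_def)

text \<open>The first \<open>2 ^ k\<close> unit steps are traded for one jump of a single
  bead.\<close>

lemma paths_add_power:
  "[paths m (2 ^ k + s) x = (\<Sum>i<m. paths m s (x(i := x i - 2 ^ k)))] (mod 2)"
  using shift_sum_power[of "{..<m}" k "paths m s" x]
  by (simp add: paths_def shift_sum_def funpow_add)

text \<open>The target positions run from 0 down to \<open>1 - m\<close> and beads never
  rise.\<close>

lemma paths_below:
  assumes "i < m" "x i \<le> - int m"
  shows "paths m s x = 0"
  using assms(2)
proof (induction s arbitrary: x)
  case 0
  have "x i \<in> x ` {..<m}" "x i \<notin> (\<lambda>i. - int i) ` {..<m}" using assms(1) 0 by auto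
  then show ?case by (auto simp: paths_0)
next
  case (Suc s)
  show ?case unfolding paths_Suc by (intro sum.neutral ballI Suc.IH) (use Suc.prems in auto)
qed

text \<open>Neither the steps nor the target condition depends on the labels of the beads.\<close>

lemma paths_permute:
  assumes "bij_betw p {..<m} {..<m}" "\<And>i. i < m \<Longrightarrow> x i = x' (p i)"
  shows "paths m s x = paths m s x'"
  using assms(2)
proof (induction s arbitrary: x x')
  case 0
  have "x ` {..<m} = x' ` p ` {..<m}" unfolding image_image using 0 by (intro image_cong) auto
  then show ?case using bij_betw_imp_surj_on[OF assms(1)] by (simp add: paths_0)
next
  case (Suc s)
  have "paths m s (x(i := x i - 1)) = paths m s (x'(p i := x' (p i) - 1))" if i: "i < m" for i
  proof (rule Suc.IH)
    fix l assume "l < m"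
    then have "p l = p i \<longleftrightarrow> l = i"
      using bij_betw_imp_inj_on[OF assms(1)] i by (auto dest: inj_onD)
    then show "(x(i := x i - 1)) l = (x'(p i := x' (p i) - 1)) (p l)"
      using Suc.prems i \<open>l < m\<close> by auto
  qed
  then have "paths m (Suc s) x = (\<Sum>i<m. paths m s (x'(p i := x' (p i) - 1)))"
    by (simp add: paths_Suc)
  also have "\<dots> = paths m (Suc s) x'"
    unfolding paths_Suc by (rule sum.reindex_bij_betw[OF assms(1)])
  finally show ?case .
qed

lemma paths_image_eq:
  assumes "inj_on x {..<m}" "inj_on x' {..<m}" "x ` {..<m} = x' ` {..<m}"
  shows "paths m s x = paths m s x'"
proof (rule paths_permute)
  have "bij_betw (the_inv_into {..<m} x' \<circ> x) {..<m} {..<m}"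
    using assms by (intro bij_betw_trans[of _ _ "x ` {..<m}"] bij_betw_the_inv_into)
      (auto simp: bij_betw_def)
  then show "bij_betw (\<lambda>i. the_inv_into {..<m} x' (x i)) {..<m} {..<m}" by (simp add: comp_def)
  show "x i = x' (the_inv_into {..<m} x' (x i))" if "i < m" for i
  proof -
    have "x i \<in> x' ` {..<m}" using assms(3) that by blast
    then show ?thesis by (rule f_the_inv_into_f[OF assms(2), symmetric])
  qed
qed

text \<open>Lowering \<open>a\<close> and lowering \<open>b\<close> give equal counts by the swap
  symmetry; lowering any other bead preserves the coincidence. In the end, coinciding beads cannot
  cover \<open>m\<close> distinct targets.\<close>

lemma paths_not_inj:
  assumes "a < m" "b < m" "a \<noteq> b" "x a = x b"
  shows "even (paths m s x)"
  using assms(4)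
proof (induction s arbitrary: x)
  case 0
  have "\<not> inj_on x {..<m}" using assms 0 by (auto dest: inj_onD)
  moreover have "inj_on x {..<m}" if "x ` {..<m} = (\<lambda>i. - int i) ` {..<m}"
    by (rule eq_card_imp_inj_on) (simp_all add: that card_image inj_on_def)
  ultimately show ?case by (auto simp: paths_0)
next
  case (Suc s)
  let ?f = "\<lambda>i. paths m s (x(i := x i - 1))"
  have "?f a = ?f b"
  proof (rule paths_permute)
    show "bij_betw (id(a := b, b := a)) {..<m} {..<m}"
      using assms by (intro bij_betw_byWitness[of _ "id(a := b, b := a)"]) auto
    show "(x(a := x a - 1)) i = (x(b := x b - 1)) ((id(a := b, b := a)) i)" for i
      using Suc.prems assms(3) by auto
  qed
  moreover have "even (\<Sum>i\<in>{..<m} - {a, b}. ?f i)"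
    by (rule dvd_sum) (auto intro!: Suc.IH simp: Suc.prems)
  moreover have "(\<Sum>i<m. ?f i) = (\<Sum>i\<in>{..<m} - {a, b}. ?f i) + (\<Sum>i\<in>{a, b}. ?f i)"
    by (rule sum.subset_diff) (use assms in auto)
  ultimately show ?case using assms(3) by (simp add: paths_Suc)
qed

section \<open>Rim hooks, path counts and the branching rule\<close>

text \<open>Removal relabels the rows of the hook while the update moves one bead in place, but both
  yield the same bead set.\<close>

lemma paths_remove:
  assumes \<mu>: "is_partition \<mu>" and j: "j < row \<mu> i" and m: "length \<mu> \<le> m"
  shows "paths m s (bead (remove_rim_hook \<mu> (i, j))) = paths m s ((bead \<mu>)(i := gap \<mu> j))"
proof (rule paths_image_eq)
  have i: "i < m" using j m by (auto simp: row_def split: if_splits)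
  have g: "gap \<mu> j \<noteq> bead \<mu> l" for l using gap_not_bead[OF \<mu>] by (metis rangeI)
  show "inj_on (bead (remove_rim_hook \<mu> (i, j))) {..<m}"
    using inj_bead[OF is_partition_remove_rim_hook[OF \<mu>]] by (rule inj_on_subset) simp
  show "inj_on ((bead \<mu>)(i := gap \<mu> j)) {..<m}"
    by (intro inj_on_fun_updI inj_on_subset[OF inj_bead[OF \<mu>]]) (use g in auto)
  have "bead (remove_rim_hook \<mu> (i, j)) ` {..<m} = insert (gap \<mu> j) (bead \<mu> ` ({..<m} - {i}))"
    by (rule bead_remove_image[OF \<mu> j]) (use col_le_length[OF \<mu>, of j] m in auto)
  also have "\<dots> = ((bead \<mu>)(i := gap \<mu> j)) ` {..<m}"
    using i by (auto simp: image_iff)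
  finally show "bead (remove_rim_hook \<mu> (i, j)) ` {..<m} = ((bead \<mu>)(i := gap \<mu> j)) ` {..<m}" .
qed

lemma finite_diagram: "finite (diagram \<mu>)"
proof -
  have "diagram \<mu> = (SIGMA i:{..<length \<mu>}. {..<\<mu> ! i})" by (auto simp: diagram_def)
  then show ?thesis by simp
qed

text \<open>A lowered bead lands on a gap, giving a rim hook removal, or on another bead. In the
  latter case the contribution is even: the two beads coincide, or the position is too low to reach
  the target.\<close>

lemma sum_paths_hooks:
  assumes \<mu>: "is_partition \<mu>" and m: "length \<mu> \<le> m" and r: "0 < r"
  shows "[(\<Sum>i<m. paths m s ((bead \<mu>)(i := bead \<mu> i - int r))) =
    (\<Sum>c | c \<in> diagram \<mu> \<and> hook_length \<mu> c = r. paths m s (bead (remove_rim_hook \<mu> c)))] (mod 2)"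
proof -
  let ?f = "\<lambda>i. paths m s ((bead \<mu>)(i := bead \<mu> i - int r))"
  define H where "H = {c \<in> diagram \<mu>. hook_length \<mu> c = r}"
  have H: "j < row \<mu> i" "gap \<mu> j = bead \<mu> i - int r" "i < m" if "(i, j) \<in> H" for i j
  proof -
    show j: "j < row \<mu> i" using that by (simp add: H_def mem_diagram)
    show "gap \<mu> j = bead \<mu> i - int r" using hook_length_eq[OF \<mu> j] that by (simp add: H_def)
    show "i < m" using j m by (auto simp: row_def split: if_splits)
  qed
  \<comment> \<open>A row contains at most one hook of length \<open>r\<close>, since distinct
    columns have distinct gaps; hooks can thus be indexed by their rows.\<close>
  have inj: "inj_on fst H"
    using H(2) inj_gap[OF \<mu>] by (force simp: inj_on_def inj_def)
  have finH: "finite H" by (simp add: H_def finite_diagram)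
  have sub: "fst ` H \<subseteq> {..<m}" using H(3) by auto
  have "even (?f i)" if i: "i \<in> {..<m} - fst ` H" for i
  proof -
    have "bead \<mu> i - int r \<in> range (bead \<mu>)"
      using hook_exists[OF \<mu> r, of i] i by (force simp: H_def)
    then obtain l where l: "bead \<mu> i - int r = bead \<mu> l" by blast
    then have "l \<noteq> i" using r by auto
    show ?thesis
    proof (cases "l < m")
      case True
      with \<open>l \<noteq> i\<close> l i show ?thesis by (intro paths_not_inj[of i m l]) auto
    next
      case False
      \<comment> \<open>The bead hit is not among the first \<open>m\<close>, so it comes from an
        empty row and lies below all targets.\<close>
      then have "bead \<mu> l \<le> - int m" using m by (simp add: bead_def row_def)
      then show ?thesis using i l by (subst paths_below[of i]) auto
    qed
  qed
  then have "even (\<Sum>i\<in>{..<m} - fst ` H. ?f i)" by (rule dvd_sum)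
  moreover have "(\<Sum>i<m. ?f i) = (\<Sum>i\<in>{..<m} - fst ` H. ?f i) + (\<Sum>i\<in>fst ` H. ?f i)"
    by (rule sum.subset_diff[OF sub]) simp
  ultimately have "[(\<Sum>i<m. ?f i) = (\<Sum>i\<in>fst ` H. ?f i)] (mod 2)"
    by (auto simp: cong_def mod_add_eq elim!: evenE)
  also have "(\<Sum>i\<in>fst ` H. ?f i) = (\<Sum>c\<in>H. ?f (fst c))"
    using inj by (simp add: sum.reindex)
  also have "\<dots> = (\<Sum>c\<in>H. paths m s (bead (remove_rim_hook \<mu> c)))"
  proof (rule sum.cong[OF refl])
    fix c assume "c \<in> H"
    moreover obtain i j where "c = (i, j)" by force
    ultimately show "?f (fst c) = paths m s (bead (remove_rim_hook \<mu> c))"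
      using H[of i j] paths_remove[OF \<mu> _ m, of j i s] by simp
  qed
  finally show ?thesis unfolding H_def .
qed

text \<open>The largest entry of a tableau sits in a corner and can be removed.\<close>

lemma num_syt_branching:
  assumes \<mu>: "is_partition \<mu>" and pos: "0 < sum_list \<mu>"
  shows "num_syt \<mu> =
    (\<Sum>c | c \<in> diagram \<mu> \<and> hook_length \<mu> c = 1. num_syt (remove_rim_hook \<mu> c))"
proof -
  define n where "n = sum_list \<mu>"
  define D where "D = diagram \<mu>"
  define C where "C = {c \<in> D. hook_length \<mu> c = 1}"
  have down: "(i', j') \<in> D" if "(i, j) \<in> D" "i' \<le> i" "j' \<le> j" for i j i' j'
    using that row_antimono[OF \<mu>, of i' i] by (auto simp: D_def mem_diagram)
  have finD: "finite D" by (simp add: D_def finite_diagram)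
  \<comment> \<open>The cells of hook length 1 are exactly the corners.\<close>
  have corner: "(i, j) \<in> C \<longleftrightarrow> (i, j) \<in> D \<and> (i, j + 1) \<notin> D \<and> (i + 1, j) \<notin> D" for i j
  proof -
    have finite: "finite (arm \<mu> (i, j) \<union> leg \<mu> (i, j))"
      by (rule finite_subset[OF _ finD]) (auto simp: arm_def leg_def D_def)
    have "hook_length \<mu> (i, j) = Suc (card (arm \<mu> (i, j) \<union> leg \<mu> (i, j)))"
      unfolding hook_length_def hook_def Un_assoc
      using finite by (simp add: arm_def leg_def)
    then have "hook_length \<mu> (i, j) = 1 \<longleftrightarrow> arm \<mu> (i, j) = {} \<and> leg \<mu> (i, j) = {}"
      using finite by auto
    moreover have "arm \<mu> (i, j) = {} \<longleftrightarrow> (i, j + 1) \<notin> D"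
      using down[of i _ i "j + 1"] by (fastforce simp: arm_def D_def)
    moreover have "leg \<mu> (i, j) = {} \<longleftrightarrow> (i + 1, j) \<notin> D"
      using down[of _ j "i + 1" j] by (fastforce simp: leg_def D_def)
    ultimately show ?thesis by (simp add: C_def)
  qed
  have diag: "diagram (remove_rim_hook \<mu> c) = D - {c}" if "c \<in> C" for c
  proof -
    obtain i j where c: "c = (i, j)" by force
    have ij: "(i, j) \<in> D" "(i, j + 1) \<notin> D" "(i + 1, j) \<notin> D" using that unfolding c corner by blast+
    have sub: "a = i \<and> b = j" if "(a, b) \<in> D" "i \<le> a" "j \<le> b" for a b
    proof -
      have "\<not> i + 1 \<le> a" using down[OF that(1), of "i + 1" j] ij(3) that(3) by blast
      moreover have "\<not> j + 1 \<le> b" using down[OF that(1), of i "j + 1"] ij(2) that(2) by blast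
      ultimately show ?thesis using that by linarith
    qed
    have "(i + 1, j + 1) \<notin> D" using down[of "i + 1" "j + 1" "i + 1" j] ij by auto
    then have "c \<in> rim_hook \<mu> c" using ij by (simp add: rim_hook_def c D_def)
    moreover have "d = c" if "d \<in> rim_hook \<mu> c" for d
      using that sub[of "fst d" "snd d"] by (simp add: rim_hook_def c D_def split_beta prod_eq_iff)
    ultimately have "rim_hook \<mu> c = {c}" by blast
    then show ?thesis using diagram_remove_rim_hook[OF \<mu>, of c] by (simp add: D_def)
  qed
  have sumr: "sum_list (remove_rim_hook \<mu> c) = n - 1" if "c \<in> C" for c
    using sum_list_remove[OF \<mu>, of c] that by (simp add: C_def D_def n_def)
  define A where "A c = {T \<in> standard_tableaux \<mu>. T c = n}" for c
  have A: "bij_betw (\<lambda>T. restrict T (D - {c})) (A c) (standard_tableaux (remove_rim_hook \<mu> c))"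
    if c: "c \<in> C" for c
  \<comment> \<open>Restriction forgets the entry \<open>n\<close> while keeping the filling
    extensional; the inverse writes \<open>n\<close> back into the corner.\<close>
  proof (rule bij_betw_byWitness[where f' = "\<lambda>T. T(c := n)"])
    have cD: "c \<in> D" using c by (simp add: C_def)
    show "\<forall>T\<in>A c. (restrict T (D - {c}))(c := n) = T"
      using cD by (auto simp: A_def standard_tableaux_def D_def extensional_def fun_eq_iff)
    show "\<forall>T\<in>standard_tableaux (remove_rim_hook \<mu> c). restrict (T(c := n)) (D - {c}) = T"
      by (auto simp: standard_tableaux_def diag[OF c] extensional_def fun_eq_iff)
    show "(\<lambda>T. restrict T (D - {c})) ` A c \<subseteq> standard_tableaux (remove_rim_hook \<mu> c)"
    proof clarify
      fix T assume "T \<in> A c"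
      then have T: "bij_betw T D {1..n}" "T c = n"
        "\<And>i j. (i, j + 1) \<in> D \<Longrightarrow> T (i, j) < T (i, j + 1)"
        "\<And>i j. (i + 1, j) \<in> D \<Longrightarrow> T (i, j) < T (i + 1, j)"
        by (auto simp: A_def standard_tableaux_def D_def n_def)
      have "bij_betw T (D - {c}) ({1..n} - {n})"
        using T(1,2) cD by (intro bij_betw_DiffI) (use pos in \<open>auto simp: bij_betw_def n_def\<close>)
      also have "{1..n} - {n} = {1..n - 1}" by auto
      finally have "bij_betw (restrict T (D - {c})) (D - {c}) {1..n - 1}"
        by (rule iffD1[OF bij_betw_cong, rotated]) simp
      moreover have "restrict T (D - {c}) (i, j) < restrict T (D - {c}) (i, j + 1)"
        if ij: "(i, j + 1) \<in> D - {c}" for i j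
      proof -
        have "(i, j) \<in> D - {c}" using ij down[of i "j + 1" i j] corner[of i j] c by auto
        then show ?thesis using ij T(3)[of i j] by simp
      qed
      moreover have "restrict T (D - {c}) (i, j) < restrict T (D - {c}) (i + 1, j)"
        if ij: "(i + 1, j) \<in> D - {c}" for i j
      proof -
        have "(i, j) \<in> D - {c}" using ij down[of "i + 1" j i j] corner[of i j] c by auto
        then show ?thesis using ij T(4)[of i j] by simp
      qed
      ultimately show "restrict T (D - {c}) \<in> standard_tableaux (remove_rim_hook \<mu> c)"
        unfolding standard_tableaux_def diag[OF c] sumr[OF c] by blast
    qed
    show "(\<lambda>T. T(c := n)) ` standard_tableaux (remove_rim_hook \<mu> c) \<subseteq> A c"
    proof clarify
      fix T assume "T \<in> standard_tableaux (remove_rim_hook \<mu> c)"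
      then have T: "T \<in> extensional (D - {c})" "bij_betw T (D - {c}) {1..n - 1}"
        "\<And>i j. (i, j + 1) \<in> D - {c} \<Longrightarrow> T (i, j) < T (i, j + 1)"
        "\<And>i j. (i + 1, j) \<in> D - {c} \<Longrightarrow> T (i, j) < T (i + 1, j)"
        by (auto simp: standard_tableaux_def diag[OF c] sumr[OF c])
      let ?T = "T(c := n)"
      have lt: "T d < n" if "d \<in> D - {c}" for d
        using bij_betwE[OF T(2)] that pos by (force simp: n_def)
      have "bij_betw ?T (D - {c}) {1..n - 1}"
        by (rule iffD1[OF bij_betw_cong, rotated, OF T(2)]) simp
      moreover have "bij_betw ?T {c} {n}" by (simp add: bij_betw_def)
      moreover have "{1..n - 1} \<inter> {n} = {}" using pos by (auto simp: n_def)
      ultimately have "bij_betw ?T ((D - {c}) \<union> {c}) ({1..n - 1} \<union> {n})"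
        by (rule bij_betw_combine)
      moreover have "(D - {c}) \<union> {c} = D" "{1..n - 1} \<union> {n} = {1..n}"
        using cD pos by (auto simp: n_def)
      ultimately have "bij_betw ?T D {1..n}" by metis
      moreover have "?T (i, j) < ?T (i, j + 1)" if "(i, j + 1) \<in> D" for i j
        using that down[of i "j + 1" i j] corner[of i j] c lt[of "(i, j)"] T(3)[of i j]
        by (cases "(i, j) = c") auto
      moreover have "?T (i, j) < ?T (i + 1, j)" if "(i + 1, j) \<in> D" for i j
        using that down[of "i + 1" j i j] corner[of i j] c lt[of "(i, j)"] T(4)[of i j]
        by (cases "(i, j) = c") auto
      moreover have "?T \<in> extensional D" using T(1) cD by (auto simp: extensional_def)
      ultimately show "?T \<in> A c"
        by (simp add: A_def standard_tableaux_def D_def n_def)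
    qed
  qed
  have finS: "finite (standard_tableaux \<nu>)" for \<nu>
  proof (rule finite_subset)
    show "standard_tableaux \<nu> \<subseteq> (\<Pi>\<^sub>E c\<in>diagram \<nu>. {1..sum_list \<nu>})"
      by (auto simp: standard_tableaux_def PiE_def dest: bij_betwE)
    show "finite (\<Pi>\<^sub>E c\<in>diagram \<nu>. {1..sum_list \<nu>})"
      by (intro finite_PiE finite_diagram) simp
  qed
  have "standard_tableaux \<mu> = (\<Union>c\<in>C. A c)"
  proof (intro equalityI subsetI)
    fix T assume T: "T \<in> standard_tableaux \<mu>"
    then have b: "bij_betw T D {1..n}"
      and inc: "\<And>i j. (i, j + 1) \<in> D \<Longrightarrow> T (i, j) < T (i, j + 1)"
        "\<And>i j. (i + 1, j) \<in> D \<Longrightarrow> T (i, j) < T (i + 1, j)"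
      by (auto simp: standard_tableaux_def D_def n_def)
    have "n \<in> T ` D" using bij_betw_imp_surj_on[OF b] pos by (simp add: n_def)
    then obtain i j where ij: "(i, j) \<in> D" "T (i, j) = n" by force
    have "T d \<le> n" if "d \<in> D" for d using bij_betwE[OF b] that by auto
    \<comment> \<open>A neighbour to the right or below would hold an entry greater than
      \<open>n\<close>.\<close>
    then have "(i, j) \<in> C" unfolding corner using inc[of i j] ij by fastforce
    then show "T \<in> (\<Union>c\<in>C. A c)" using T ij by (auto simp: A_def)
  qed (auto simp: A_def)
  then have "num_syt \<mu> = card (\<Union>c\<in>C. A c)" by (simp add: num_syt_def)
  also have "\<dots> = (\<Sum>c\<in>C. card (A c))"
  proof (rule card_UN_disjoint)
    show "finite C" using finD by (simp add: C_def)
    show "\<forall>c\<in>C. finite (A c)" using finS[of \<mu>] by (simp add: A_def)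
    have "c = d" if "T \<in> A c" "T \<in> A d" "c \<in> C" "d \<in> C" for T c d
    proof -
      have "inj_on T D" using that(1) by (simp add: A_def standard_tableaux_def bij_betw_def D_def)
      then show ?thesis using that by (auto simp: A_def C_def dest: inj_onD)
    qed
    then show "\<forall>c\<in>C. \<forall>d\<in>C. c \<noteq> d \<longrightarrow> A c \<inter> A d = {}" by blast
  qed
  also have "\<dots> = (\<Sum>c\<in>C. num_syt (remove_rim_hook \<mu> c))"
    unfolding num_syt_def by (intro sum.cong refl bij_betw_same_card[OF A])
  finally show ?thesis by (simp add: C_def D_def)
qed

section \<open>Parity of the number of standard tableaux\<close>

text \<open>The branching rule over corners and the unit steps of paths are the same recursion
  modulo 2, by \<open>sum_paths_hooks\<close> with \<open>r = 1\<close>.\<close>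

lemma num_syt_cong_paths:
  assumes "is_partition \<mu>" "length \<mu> \<le> m"
  shows "[num_syt \<mu> = paths m (sum_list \<mu>) (bead \<mu>)] (mod 2)"
  using assms
proof (induction "sum_list \<mu>" arbitrary: \<mu>)
  case 0
  then have "\<mu> = []" by (cases \<mu>) (auto simp: is_partition_def)
  moreover have "standard_tableaux [] = {\<lambda>c. undefined}"
    by (auto simp: standard_tableaux_def diagram_def bij_betw_def)
  moreover have "bead [] = (\<lambda>i. - int i)" by (simp add: bead_def row_def fun_eq_iff)
  ultimately show ?case by (simp add: num_syt_def paths_0)
next
  case (Suc s)
  let ?H = "{c \<in> diagram \<mu>. hook_length \<mu> c = 1}"
  have sl: "sum_list (remove_rim_hook \<mu> c) = s" if "c \<in> ?H" for c
    using sum_list_remove[OF Suc.prems(1), of c] that Suc.hyps(2) by simp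
  have "num_syt \<mu> = (\<Sum>c\<in>?H. num_syt (remove_rim_hook \<mu> c))"
    using num_syt_branching[OF Suc.prems(1)] Suc.hyps(2) by simp
  also have "[\<dots> = (\<Sum>c\<in>?H. paths m s (bead (remove_rim_hook \<mu> c)))] (mod 2)"
  proof (rule cong_sum)
    fix c assume "c \<in> ?H"
    then show "[num_syt (remove_rim_hook \<mu> c) = paths m s (bead (remove_rim_hook \<mu> c))] (mod 2)"
      using Suc.hyps(1)[of "remove_rim_hook \<mu> c"] sl[of c] length_remove[of \<mu> c] Suc.prems
        is_partition_remove_rim_hook[OF Suc.prems(1), of c] by simp
  qed
  also have "[(\<Sum>c\<in>?H. paths m s (bead (remove_rim_hook \<mu> c))) =
      (\<Sum>i<m. paths m s ((bead \<mu>)(i := bead \<mu> i - 1)))] (mod 2)"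
    using sum_paths_hooks[OF Suc.prems, of 1 s] by (simp add: cong_sym)
  also have "(\<Sum>i<m. paths m s ((bead \<mu>)(i := bead \<mu> i - 1))) = paths m (sum_list \<mu>) (bead \<mu>)"
    by (simp add: paths_Suc Suc.hyps(2)[symmetric])
  finally show ?case .
qed

text \<open>Tableaux are translated to paths, the first \<open>2 ^ k\<close> steps are merged into
  one jump, and the remaining paths are translated back.\<close>

lemma num_syt_cong_hooks:
  assumes \<mu>: "is_partition \<mu>" and k: "2 ^ k \<le> sum_list \<mu>"
  shows "[num_syt \<mu> = (\<Sum>c | c \<in> diagram \<mu> \<and> hook_length \<mu> c = 2 ^ k.
    num_syt (remove_rim_hook \<mu> c))] (mod 2)"
proof -
  let ?H = "{c \<in> diagram \<mu>. hook_length \<mu> c = 2 ^ k}" and ?m = "length \<mu>"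
  define s where "s = sum_list \<mu> - 2 ^ k"
  have sl: "sum_list (remove_rim_hook \<mu> c) = s" if "c \<in> ?H" for c
    using sum_list_remove[OF \<mu>, of c] that by (simp add: s_def)
  have "[num_syt \<mu> = paths ?m (2 ^ k + s) (bead \<mu>)] (mod 2)"
    using num_syt_cong_paths[OF \<mu> order_refl] k by (simp add: s_def)
  also have "[paths ?m (2 ^ k + s) (bead \<mu>) =
      (\<Sum>i<?m. paths ?m s ((bead \<mu>)(i := bead \<mu> i - 2 ^ k)))] (mod 2)"
    by (rule paths_add_power)
  also have "[(\<Sum>i<?m. paths ?m s ((bead \<mu>)(i := bead \<mu> i - 2 ^ k))) =
      (\<Sum>c\<in>?H. paths ?m s (bead (remove_rim_hook \<mu> c)))] (mod 2)"
    using sum_paths_hooks[OF \<mu> order_refl, of "2 ^ k" s] by simp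
  also have "[(\<Sum>c\<in>?H. paths ?m s (bead (remove_rim_hook \<mu> c))) =
      (\<Sum>c\<in>?H. num_syt (remove_rim_hook \<mu> c))] (mod 2)"
  proof (rule cong_sum)
    fix c assume "c \<in> ?H"
    then show "[paths ?m s (bead (remove_rim_hook \<mu> c)) = num_syt (remove_rim_hook \<mu> c)] (mod 2)"
      using num_syt_cong_paths[OF is_partition_remove_rim_hook[OF \<mu>] length_remove, of c] sl[of c]
      by (simp add: cong_sym)
  qed
  finally show ?thesis .
qed

text \<open>In this size range the sum over hooks has at most one term.\<close>

lemma odd_num_syt_iff:
  assumes \<mu>: "is_partition \<mu>" and k: "2 ^ k \<le> sum_list \<mu>" "sum_list \<mu> < 2 ^ (k + 1)"
  shows "odd (num_syt \<mu>) \<longleftrightarrow>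
    (\<exists>c\<in>diagram \<mu>. hook_length \<mu> c = 2 ^ k \<and> odd (num_syt (remove_rim_hook \<mu> c)))"
proof -
  let ?H = "{c \<in> diagram \<mu>. hook_length \<mu> c = 2 ^ k}"
  have "odd (num_syt \<mu>) \<longleftrightarrow> odd (\<Sum>c\<in>?H. num_syt (remove_rim_hook \<mu> c))"
    using num_syt_cong_hooks[OF \<mu> k(1)] by (rule cong_dvd_iff[THEN arg_cong[of _ _ Not]])
  moreover have "odd (\<Sum>c\<in>?H. num_syt (remove_rim_hook \<mu> c)) \<longleftrightarrow>
      (\<exists>c\<in>?H. odd (num_syt (remove_rim_hook \<mu> c)))"
  proof -
    have "c = d" if "c \<in> ?H" "d \<in> ?H" for c d
      using hook_unique[OF \<mu>, of c d "2 ^ k"] k(2) that by simp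
    then consider "?H = {}" | c where "?H = {c}" by blast
    then show ?thesis
    proof cases
      case 1
      show ?thesis unfolding 1 by simp
    next
      case (2 c)
      show ?thesis unfolding 2 by simp
    qed
  qed
  ultimately show ?thesis by blast
qed

section \<open>Binomial coefficients modulo 2\<close>

text \<open>Absorption gives \<open>2 ^ k dvd i * ((2 ^ k) choose i)\<close>; an odd binomial would
  force \<open>2 ^ k dvd i\<close>.\<close>

lemma even_power2_choose:
  assumes "0 < i" "i < 2 ^ k"
  shows "even ((2 ^ k :: nat) choose i)"
proof (rule ccontr)
  assume "odd ((2 ^ k :: nat) choose i)"
  then have "coprime (2 ^ k) ((2 ^ k :: nat) choose i)" by simp
  moreover have "i * ((2 ^ k) choose i) = 2 ^ k * ((2 ^ k - 1) choose (i - 1))"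
    using assms by (intro times_binomial_minus1_eq) auto
  then have "(2 ^ k :: nat) dvd i * ((2 ^ k) choose i)" by simp
  ultimately have "2 ^ k dvd i" by (simp add: coprime_dvd_mult_left_iff)
  with assms show False by (auto dest: dvd_imp_le)
qed

text \<open>This is the coefficient form of \<open>(1 + x) ^ (2 ^ k + s)\<close> being congruent to
  \<open>(1 + x ^ (2 ^ k)) * (1 + x) ^ s\<close>. The case distinction guards the truncated
  subtraction.\<close>

lemma choose_power2_cong:
  "[((2 ^ k + s) choose a) = (s choose a) + (if 2 ^ k \<le> a then s choose (a - 2 ^ k) else 0)] (mod 2)"
proof -
  let ?f = "\<lambda>i. ((2 ^ k) choose i) * (s choose (a - i))"
  have "(2 ^ k + s) choose a = (\<Sum>i\<le>a. ?f i)" by (rule vandermonde[symmetric])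
  also have "[\<dots> = (\<Sum>i\<le>a. if i = 0 \<or> i = 2 ^ k then s choose (a - i) else 0)] (mod 2)"
  proof (rule cong_sum)
    fix i
    show "[?f i = (if i = 0 \<or> i = 2 ^ k then s choose (a - i) else 0)] (mod 2)"
      using even_power2_choose[of i k]
      by (cases i "2 ^ k :: nat" rule: linorder_cases)
        (auto simp: cong_0_iff binomial_eq_0)
  qed
  also have "(\<Sum>i\<le>a. if i = 0 \<or> i = 2 ^ k then s choose (a - i) else 0) =
      (\<Sum>i\<in>(if 2 ^ k \<le> a then {0, 2 ^ k} else {0}). s choose (a - i))"
    by (rule sum.mono_neutral_cong_right) (auto split: if_splits)
  also have "\<dots> = (s choose a) + (if 2 ^ k \<le> a then s choose (a - 2 ^ k) else 0)"
    by simp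
  finally show ?thesis .
qed

section \<open>Odd bipartitions\<close>

lemma bip_dim_choose:
  "bip_dim \<alpha> \<beta> = ((sum_list \<alpha> + sum_list \<beta>) choose sum_list \<alpha>) * num_syt \<alpha> * num_syt \<beta>"
  by (simp add: bip_dim_def binomial_fact')

lemma bip_dim_commute: "bip_dim \<alpha> \<beta> = bip_dim \<beta> \<alpha>"
  by (simp add: bip_dim_def ac_simps)

lemma bipartition_commute: "bipartition n \<alpha> \<beta> \<longleftrightarrow> bipartition n \<beta> \<alpha>"
  by (auto simp: bipartition_def)

lemma odd_bipartition_commute: "odd_bipartition n \<alpha> \<beta> \<longleftrightarrow> odd_bipartition n \<beta> \<alpha>"
  by (simp add: odd_bipartition_def bip_dim_commute[of \<alpha>] bipartition_commute[of n \<alpha>])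

text \<open>Removing the hook preserves the parity of the binomial factor and leaves that of \<beta>
  alone, so only the tableau count of \<alpha> matters.\<close>

lemma odd_bipartition_iff_large:
  assumes b: "bipartition n \<alpha> \<beta>" and n: "n < 2 ^ (k + 1)" and large: "2 ^ k \<le> sum_list \<alpha>"
  shows "odd_bipartition n \<alpha> \<beta> \<longleftrightarrow> (\<exists>c\<in>diagram \<alpha>. hook_length \<alpha> c = 2 ^ k \<and>
    odd_bipartition (n - 2 ^ k) (remove_rim_hook \<alpha> c) \<beta>)"
proof -
  have \<alpha>: "is_partition \<alpha>" and \<beta>: "is_partition \<beta>" and s: "sum_list \<alpha> + sum_list \<beta> = n"
    using b by (auto simp: bipartition_def)
  define a where "a = sum_list \<alpha> - 2 ^ k"
  have a: "sum_list \<alpha> = 2 ^ k + a" using large by (simp add: a_def)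
  \<comment> \<open>One of the two terms of the congruence vanishes, as
    \<open>n - 2 ^ k < 2 ^ k\<close>.\<close>
  have "(a + sum_list \<beta>) choose (2 ^ k + a) = 0"
    using s n a by (intro binomial_eq_0) simp
  then have "[(2 ^ k + (a + sum_list \<beta>)) choose (2 ^ k + a) = (a + sum_list \<beta>) choose a] (mod 2)"
    using choose_power2_cong[of k "a + sum_list \<beta>" "2 ^ k + a"] by (simp add: binomial_eq_0)
  then have ch: "odd (n choose sum_list \<alpha>) \<longleftrightarrow> odd ((a + sum_list \<beta>) choose a)"
    using s a by (auto simp: add.assoc dest: cong_dvd_iff)
  have rem: "odd_bipartition (n - 2 ^ k) (remove_rim_hook \<alpha> c) \<beta> \<longleftrightarrow>
      odd ((a + sum_list \<beta>) choose a) \<and> odd (num_syt (remove_rim_hook \<alpha> c)) \<and> odd (num_syt \<beta>)"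
    if "c \<in> diagram \<alpha>" "hook_length \<alpha> c = 2 ^ k" for c
  proof -
    have "sum_list (remove_rim_hook \<alpha> c) = a"
      using sum_list_remove[OF \<alpha> that(1)] that(2) a by simp
    then show ?thesis
      using a s is_partition_remove_rim_hook[OF \<alpha>, of c] \<beta>
      by (auto simp: odd_bipartition_def bipartition_def bip_dim_choose)
  qed
  have "odd_bipartition n \<alpha> \<beta> \<longleftrightarrow>
      odd ((a + sum_list \<beta>) choose a) \<and> odd (num_syt \<alpha>) \<and> odd (num_syt \<beta>)"
    using b s ch by (simp add: odd_bipartition_def bip_dim_choose)
  then show ?thesis using odd_num_syt_iff[OF \<alpha> large] s n rem by auto
qed

text \<open>If both components had fewer than \<open>2 ^ k\<close> cells, then
  \<open>n - 2 ^ k < sum_list \<alpha> < 2 ^ k\<close>, and both terms of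
  \<open>choose_power2_cong\<close> would vanish.\<close>

lemma odd_bipartition_large:
  assumes "odd_bipartition n \<alpha> \<beta>" and "2 ^ k \<le> n"
  shows "2 ^ k \<le> sum_list \<alpha> \<or> 2 ^ k \<le> sum_list \<beta>"
proof (rule ccontr)
  assume "\<not> ?thesis"
  moreover have s: "sum_list \<alpha> + sum_list \<beta> = n"
    using assms by (simp add: odd_bipartition_def bipartition_def)
  ultimately have "(n - 2 ^ k) choose sum_list \<alpha> = 0" "\<not> 2 ^ k \<le> sum_list \<alpha>"
    using assms(2) by (auto intro!: binomial_eq_0)
  then have "even (n choose sum_list \<alpha>)"
    using choose_power2_cong[of k "n - 2 ^ k" "sum_list \<alpha>"] assms(2) by (simp add: binomial_eq_0 cong_0_iff)
  then show False using assms s by (simp add: odd_bipartition_def bip_dim_choose)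
qed

text \<open>Either side forces some component to have at least \<open>2 ^ k\<close> cells, and the
  previous equivalence applies to that component, after swapping if it is \<beta>.\<close>

lemma odd_bipartition_iff:
  assumes b: "bipartition n \<alpha> \<beta>" and n: "2 ^ k \<le> n" "n < 2 ^ (k + 1)"
  shows "odd_bipartition n \<alpha> \<beta> \<longleftrightarrow>
    (\<exists>c\<in>diagram \<alpha>. hook_length \<alpha> c = 2 ^ k \<and>
       odd_bipartition (n - 2 ^ k) (remove_rim_hook \<alpha> c) \<beta>) \<or>
    (\<exists>c\<in>diagram \<beta>. hook_length \<beta> c = 2 ^ k \<and>
       odd_bipartition (n - 2 ^ k) \<alpha> (remove_rim_hook \<beta> c))"
    (is "_ \<longleftrightarrow> ?A \<or> ?B")
proof -
  have \<alpha>: "is_partition \<alpha>" and \<beta>: "is_partition \<beta>"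
    using b by (auto simp: bipartition_def)
  have A: "odd_bipartition n \<alpha> \<beta> \<longleftrightarrow> ?A" if "2 ^ k \<le> sum_list \<alpha>"
    using odd_bipartition_iff_large[OF b n(2) that] .
  have B: "odd_bipartition n \<alpha> \<beta> \<longleftrightarrow> ?B" if "2 ^ k \<le> sum_list \<beta>"
    using odd_bipartition_iff_large[of n \<beta> \<alpha> k] b n(2) that
    by (simp add: odd_bipartition_commute[of _ \<alpha>] bipartition_commute[of _ \<alpha>])
  have "?A \<Longrightarrow> 2 ^ k \<le> sum_list \<alpha>" using hook_length_le[OF \<alpha>] by fastforce
  moreover have "?B \<Longrightarrow> 2 ^ k \<le> sum_list \<beta>" using hook_length_le[OF \<beta>] by fastforce
  ultimately show ?thesis using A B odd_bipartition_large[OF _ n(1)] by blast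
qed

theorem theorem10:
  fixes n k :: nat
  assumes "0 < n" and "2 ^ k \<le> n" and "n < 2 ^ (k + 1)"
  shows
    "(\<forall>\<alpha> \<beta>. bipartition n \<alpha> \<beta> \<longrightarrow>
        (odd_bipartition n \<alpha> \<beta> \<longleftrightarrow>
          (\<exists>c\<in>diagram \<alpha>. hook_length \<alpha> c = 2 ^ k \<and>
             odd_bipartition (n - 2 ^ k) (remove_rim_hook \<alpha> c) \<beta>) \<or>
          (\<exists>c\<in>diagram \<beta>. hook_length \<beta> c = 2 ^ k \<and>
             odd_bipartition (n - 2 ^ k) \<alpha> (remove_rim_hook \<beta> c)))) \<and>
     (\<forall>\<alpha> \<beta> \<alpha>' \<beta>'. odd_bipartition n \<alpha> \<beta> \<longrightarrow> odd_bipartition n \<alpha>' \<beta>' \<longrightarrow>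
        (\<forall>c\<in>diagram \<alpha>. \<forall>c'\<in>diagram \<alpha>'.
           hook_length \<alpha> c = 2 ^ k \<longrightarrow> hook_length \<alpha>' c' = 2 ^ k \<longrightarrow>
           leg_length \<alpha> c = leg_length \<alpha>' c' \<longrightarrow>
           (remove_rim_hook \<alpha> c, \<beta>) = (remove_rim_hook \<alpha>' c', \<beta>') \<longrightarrow>
           (\<alpha>, \<beta>) = (\<alpha>', \<beta>')) \<and>
        (\<forall>c\<in>diagram \<beta>. \<forall>c'\<in>diagram \<beta>'.
           hook_length \<beta> c = 2 ^ k \<longrightarrow> hook_length \<beta>' c' = 2 ^ k \<longrightarrow>
           leg_length \<beta> c = leg_length \<beta>' c' \<longrightarrow>
           (\<alpha>, remove_rim_hook \<beta> c) = (\<alpha>', remove_rim_hook \<beta>' c') \<longrightarrow>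
           (\<alpha>, \<beta>) = (\<alpha>', \<beta>')))"
proof (intro conjI allI impI ballI)
  fix \<alpha> \<beta> assume "bipartition n \<alpha> \<beta>"
  then show "odd_bipartition n \<alpha> \<beta> \<longleftrightarrow>
    (\<exists>c\<in>diagram \<alpha>. hook_length \<alpha> c = 2 ^ k \<and>
       odd_bipartition (n - 2 ^ k) (remove_rim_hook \<alpha> c) \<beta>) \<or>
    (\<exists>c\<in>diagram \<beta>. hook_length \<beta> c = 2 ^ k \<and>
       odd_bipartition (n - 2 ^ k) \<alpha> (remove_rim_hook \<beta> c))"
    using odd_bipartition_iff assms by blast
next
  fix \<alpha> \<beta> \<alpha>' \<beta>' c c'
  assume odd: "odd_bipartition n \<alpha> \<beta>" "odd_bipartition n \<alpha>' \<beta>'"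
  then have p: "is_partition \<alpha>" "is_partition \<alpha>'" "is_partition \<beta>" "is_partition \<beta>'"
    and small: "sum_list \<alpha> < 2 * 2 ^ k" "sum_list \<beta> < 2 * 2 ^ k"
    using assms by (auto simp: odd_bipartition_def bipartition_def)
  {
    assume "c \<in> diagram \<alpha>" "c' \<in> diagram \<alpha>'"
      "hook_length \<alpha> c = 2 ^ k" "hook_length \<alpha>' c' = 2 ^ k"
      "leg_length \<alpha> c = leg_length \<alpha>' c'"
      "(remove_rim_hook \<alpha> c, \<beta>) = (remove_rim_hook \<alpha>' c', \<beta>')"
    then show "(\<alpha>, \<beta>) = (\<alpha>', \<beta>')"
      using removed_determines[OF p(1,2)] small(1) by simp
  }
  {
    assume "c \<in> diagram \<beta>" "c' \<in> diagram \<beta>'"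
      "hook_length \<beta> c = 2 ^ k" "hook_length \<beta>' c' = 2 ^ k"
      "leg_length \<beta> c = leg_length \<beta>' c'"
      "(\<alpha>, remove_rim_hook \<beta> c) = (\<alpha>', remove_rim_hook \<beta>' c')"
    then show "(\<alpha>, \<beta>) = (\<alpha>', \<beta>')"
      using removed_determines[OF p(3,4)] small(2) by simp
  }
qed

end
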